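(* The integers $0,1,2,3,4$ are MC, with MC-radii $R_0=\sqrt{2}/2$, $R_1=1$, $R_2=\sqrt{5}/2$, $R_3=5\sqrt{2}/6$, and $R_4=\sqrt{10}/2$.
   Context: A lattice point is a point of the $xy$-plane with integer coordinates. A circle is the 1-dimensional boundary of a disk of positive radius. A circle encloses a point if the point lies in the open disk bounded by the circle (points on the circumference are not enclosed). For a nonnegative integer $n$, a circle (with arbitrary real center) is $n$-enclosing if it encloses exactly $n$ lattice points. A nonnegative integer $n$ is MC (maximally circlable) if among all $n$-enclosing circles there is one of largest radius; this largest radius is called the MC-radius of $n$ and denoted $R_n$. *)

theory Defs
  imports "HOL-Analysis.Analysis"
begin

text \<open>The plane is \<^typ>\<open>real \<times> real\<close>, whose library metric is the Euclidean one.\<close>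

definition lattice_points :: "(real \<times> real) set" where
  "lattice_points = \<int> \<times> \<int>"

text \<open>A circle \<open>sphere c r\<close> with \<open>r > 0\<close> is represented by its center and radius; the open
  disk it bounds is \<open>ball c r\<close>. The finiteness conjunct only rules out reading
  \<open>card = 0\<close> as ``infinitely many''.\<close>

definition n_enclosing :: "nat \<Rightarrow> real \<times> real \<Rightarrow> real \<Rightarrow> bool" where
  "n_enclosing n c r \<longleftrightarrow>
     r > 0 \<and> finite (lattice_points \<inter> ball c r) \<and> card (lattice_points \<inter> ball c r) = n"

definition MC :: "nat \<Rightarrow> bool" where
  "MC n \<longleftrightarrow> (\<exists>c r. n_enclosing n c r \<and> (\<forall>c' r'. n_enclosing n c' r' \<longrightarrow> r' \<le> r))"

text \<open>Meaningful only when \<open>MC n\<close> holds.\<close>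

definition MC_radius :: "nat \<Rightarrow> real" where
  "MC_radius n = (GREATEST r. \<exists>c. n_enclosing n c r)"

end

(* Lattice symmetries move the center of any circle to a point (x, y) with 0 <= y <= x <= 1/2.
   For such a center it suffices to exhibit n + 1 lattice points in the closed disk of radius R_n:
   a circle of larger radius then encloses more than n points. The points are taken in the order
   (0,0), (1,0), (0,1), followed by the nearer of (1,1) and (0,-1), followed by the other one.
   The worst centers are (1/2,1/2), (0,0), (1/2,0), (1/6,1/6), (1/2,1/2) respectively, and there
   the radius R_n is attained. *)
theory Submission imports Defs begin

text \<open>Radii are kept in the form \<open>sqrt s\<close>, so that every distance comparison
  becomes a polynomial inequality in the coordinates.\<close>

lemma dist_le_sqrt_iff:
  fixes a b u v s :: real
  shows "dist (u, v) (a, b) \<le> sqrt s \<longleftrightarrow> (u - a)\<^sup>2 + (v - b)\<^sup>2 \<le> s"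
  by (simp add: dist_Pair_Pair dist_real_def)

lemma mem_ball_sqrt_iff:
  fixes a b u v s :: real
  shows "(u, v) \<in> ball (a, b) (sqrt s) \<longleftrightarrow> (u - a)\<^sup>2 + (v - b)\<^sup>2 < s"
  by (simp add: dist_Pair_Pair dist_real_def power2_commute)

text \<open>Round to the nearest integer; the sign of the remainder is split off so that it can
  serve as a reflection.\<close>

lemma real_eq_Int_plus_sign_times:
  fixes u :: real
  obtains k s x where "k \<in> \<int>" "s \<in> {1, -1}" "0 \<le> x" "x \<le> 1/2" "u = k + s * x"
proof
  let ?s = "if u \<ge> of_int (round u) then 1 else -1 :: real"
  show "of_int (round u) \<in> (\<int> :: real set)" "?s \<in> {1, -1}" by auto
  show "0 \<le> \<bar>u - of_int (round u)\<bar>" by simp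
  show "\<bar>u - of_int (round u)\<bar> \<le> 1/2"
    using of_int_round_abs_le[of u] by (simp add: abs_minus_commute)
  show "u = of_int (round u) + ?s * \<bar>u - of_int (round u)\<bar>" by auto
qed

text \<open>In each coordinate \<open>g\<close> is an integer translation after a possible
  reflection; if this leaves the center above the diagonal, swapping the coordinates comes
  first.\<close>

lemma lattice_symmetry_to_triangle:
  fixes c :: "real \<times> real"
  obtains x y :: real and g :: "real \<times> real \<Rightarrow> real \<times> real"
  where "0 \<le> y" "y \<le> x" "x \<le> 1/2" "inj g" "g ` lattice_points \<subseteq> lattice_points"
    "\<forall>p. dist (g p) c = dist p (x, y)"
proof -
  obtain k s x where x: "k \<in> \<int>" "s \<in> {1, -1}" "0 \<le> x" "x \<le> 1/2" "fst c = k + s * x"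
    by (rule real_eq_Int_plus_sign_times)
  obtain l t y where y: "l \<in> \<int>" "t \<in> {1, -1}" "0 \<le> y" "y \<le> 1/2" "snd c = l + t * y"
    by (rule real_eq_Int_plus_sign_times)
  have c: "c = (k + s * x, l + t * y)"
    using x(5) y(5) by (simp add: prod_eq_iff)
  define h where "h p = (k + s * fst p, l + t * snd p)" for p :: "real \<times> real"
  have h: "inj h" "h ` lattice_points \<subseteq> lattice_points"
    using x(1,2) y(1,2) by (auto simp: h_def lattice_points_def inj_def prod_eq_iff)
  have dist_h: "dist (h p) c = dist p (x, y)" for p
    using x(2) y(2)
    by (cases p) (auto simp: h_def c dist_Pair_Pair dist_real_def power2_commute)
  show thesis
  proof (cases "y \<le> x")
    case True
    then show thesis
      using that[of y x h] x y h dist_h by simp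
  next
    case False
    have "inj (h \<circ> prod.swap)"
      using h(1) by (intro inj_compose) auto
    moreover have "(h \<circ> prod.swap) ` lattice_points \<subseteq> lattice_points"
      using h(2) by (auto simp: lattice_points_def image_subset_iff)
    moreover have "dist ((h \<circ> prod.swap) p) c = dist p (y, x)" for p
      by (cases p) (simp add: dist_h dist_Pair_Pair add.commute)
    ultimately show thesis
      using that[of x y "h \<circ> prod.swap"] x y False by simp
  qed
qed

lemma n_enclosing_radius_le:
  assumes n: "n_enclosing n c r"
    and close: "\<And>x y. 0 \<le> y \<Longrightarrow> y \<le> x \<Longrightarrow> x \<le> 1/2 \<Longrightarrow>
      \<exists>P \<subseteq> lattice_points. n < card P \<and> (\<forall>p\<in>P. dist p (x, y) \<le> R)"
  shows "r \<le> R"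
proof (rule ccontr)
  assume "\<not> r \<le> R"
  obtain x y g where g: "0 \<le> y" "y \<le> x" "x \<le> 1/2" "inj g"
    "g ` lattice_points \<subseteq> lattice_points" "\<forall>p. dist (g p) c = dist p (x, y)"
    by (rule lattice_symmetry_to_triangle)
  obtain P where P: "P \<subseteq> lattice_points" "n < card P" "\<forall>p\<in>P. dist p (x, y) \<le> R"
    using close[OF g(1-3)] by blast
  have "dist c (g p) \<le> R" if "p \<in> P" for p
    using P(3) that g(6) by (metis dist_commute)
  then have "dist c (g p) < r" if "p \<in> P" for p
    using that \<open>\<not> r \<le> R\<close> by fastforce
  then have "g ` P \<subseteq> lattice_points \<inter> ball c r"
    using P(1) g(5) unfolding image_subset_iff Int_iff mem_ball by blast
  \<comment> \<open>Monotonicity of \<open>card\<close> relies on the finiteness contained in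
    \<open>n_enclosing\<close>.\<close>
  then have "card (g ` P) \<le> n"
    using n card_mono unfolding n_enclosing_def by metis
  moreover have "card (g ` P) = card P"
    using g(4) by (meson card_image inj_on_subset subset_UNIV)
  ultimately show False
    using P(2) by simp
qed

lemma MC_radius_eqI:
  assumes "n_enclosing n c R"
    and "\<And>x y. 0 \<le> y \<Longrightarrow> y \<le> x \<Longrightarrow> x \<le> 1/2 \<Longrightarrow>
      \<exists>P \<subseteq> lattice_points. n < card P \<and> (\<forall>p\<in>P. dist p (x, y) \<le> R)"
  shows "MC n \<and> MC_radius n = R"
proof -
  have "r \<le> R" if "n_enclosing n c r" for c r
    using that assms(2) by (rule n_enclosing_radius_le)
  with assms(1) show ?thesis
    unfolding MC_def MC_radius_def by (intro conjI Greatest_equality) blast+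
qed

text \<open>Each offset from the center is below 2 in absolute value, so each coordinate lies
  strictly between -2 and 5/2. This leaves 16 candidate points to check.\<close>

lemma lattice_ball_coordinates:
  assumes "p \<in> lattice_points \<inter> ball (a, b) (sqrt s)" "s \<le> 4"
    and "a \<in> {0..1/2}" "b \<in> {0..1/2}"
  obtains i j where "p = (i, j)" "i \<in> {-1, 0, 1, 2}" "j \<in> {-1, 0, 1, 2}"
    "(i - a)\<^sup>2 + (j - b)\<^sup>2 < s"
proof -
  obtain i j :: int where p: "p = (of_int i, of_int j)"
    using assms(1) by (auto simp: lattice_points_def elim!: Ints_cases)
  have lt: "(of_int i - a)\<^sup>2 + (of_int j - b)\<^sup>2 < s"
    using assms(1) unfolding p Int_iff mem_ball_sqrt_iff by blast
  have bound: "k \<in> {-1, 0, 1, 2}"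
    if "(of_int k - z)\<^sup>2 < 4" "z \<in> {0..1/2}" for k :: int and z :: real
  proof -
    have "\<bar>of_int k - z\<bar> < 2"
      using that(1) power2_less_imp_less[of "\<bar>of_int k - z\<bar>" 2] by simp
    then have "k < 3" "k > -2"
      using that(2) by auto
    then have "k = -1 \<or> k = 0 \<or> k = 1 \<or> k = 2"
      by linarith
    then show ?thesis by simp
  qed
  have "(of_int i - a)\<^sup>2 < 4" "(of_int j - b)\<^sup>2 < 4"
    using lt assms(2) zero_le_power2[of "of_int i - a"] zero_le_power2[of "of_int j - b"]
    by linarith+
  then have "i \<in> {-1, 0, 1, 2}" "j \<in> {-1, 0, 1, 2}"
    using bound assms(3,4) by blast+
  then show thesis
    using that[of "of_int i" "of_int j"] p lt by auto
qed

lemma n_enclosingI: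
  assumes "0 < s" "s \<le> 4" "a \<in> {0..1/2}" "b \<in> {0..1/2}"
    and "finite P" "card P = n"
    and mem: "\<And>i j. i \<in> {-1, 0, 1, 2} \<Longrightarrow> j \<in> {-1, 0, 1, 2} \<Longrightarrow>
      (i - a)\<^sup>2 + (j - b)\<^sup>2 < s \<Longrightarrow> (i, j) \<in> P"
    and sub: "\<And>i j. (i, j) \<in> P \<Longrightarrow> i \<in> \<int> \<and> j \<in> \<int> \<and> (i - a)\<^sup>2 + (j - b)\<^sup>2 < s"
  shows "n_enclosing n (a, b) (sqrt s)"
proof -
  have "lattice_points \<inter> ball (a, b) (sqrt s) = P"
  proof (intro equalityI subsetI)
    fix p assume "p \<in> lattice_points \<inter> ball (a, b) (sqrt s)"
    then show "p \<in> P"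
      using assms(2-4) mem by (metis lattice_ball_coordinates)
  next
    fix p assume "p \<in> P"
    then show "p \<in> lattice_points \<inter> ball (a, b) (sqrt s)"
      using sub by (cases p) (simp add: lattice_points_def mem_ball_sqrt_iff del: mem_ball)
  qed
  with assms(1,5,6) show ?thesis
    by (simp add: n_enclosing_def)
qed

text \<open>In this and the next four circles the nearest points not enclosed lie exactly on the
  circumference; here they are the corners of the unit square.\<close>

lemma n_enclosing_0: "n_enclosing 0 (1/2, 1/2) (sqrt (1/2))"
  by (rule n_enclosingI[where P = "{}"]) (auto simp: power2_eq_square)

lemma n_enclosing_1: "n_enclosing 1 (0, 0) (sqrt 1)"
  by (rule n_enclosingI[where P = "{(0, 0)}"]) (auto simp: power2_eq_square)

lemma n_enclosing_2: "n_enclosing 2 (1/2, 0) (sqrt (5/4))"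
  by (rule n_enclosingI[where P = "{(0, 0), (1, 0)}"]) (auto simp: power2_eq_square)

text \<open>The center is the circumcenter of (1,1), (0,-1) and (-1,0).\<close>

lemma n_enclosing_3: "n_enclosing 3 (1/6, 1/6) (sqrt (25/18))"
  by (rule n_enclosingI[where P = "{(0, 0), (1, 0), (0, 1)}"]) (auto simp: power2_eq_square)

lemma n_enclosing_4: "n_enclosing 4 (1/2, 1/2) (sqrt (5/2))"
  by (rule n_enclosingI[where P = "{(0, 0), (1, 0), (0, 1), (1, 1)}"])
    (auto simp: power2_eq_square)

context
  fixes x y :: real
  assumes y: "0 \<le> y" and yx: "y \<le> x" and x: "x \<le> 1/2"
begin

text \<open>On [0, 1/2] the convex square lies below its chord; this makes the estimates that follow
  linear.\<close>

lemma x_square_le: "x\<^sup>2 \<le> x / 2" and y_square_le: "y\<^sup>2 \<le> y / 2"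
  using y yx x mult_left_mono[of x "1/2" x] mult_left_mono[of y "1/2" y]
  by (auto simp: power2_eq_square)

text \<open>All bounds but \<open>sq_dist_11\<close> are sharp, at (1/2,1/2), (0,0), (1/2,0) and
  (1/2,1/2) in order; \<open>sq_dist_11\<close> takes the same bound as \<open>sq_dist_0m1\<close>,
  with which it is used.\<close>

lemma sq_dist_00: "x\<^sup>2 + y\<^sup>2 \<le> 1/2"
  and sq_dist_10: "(1 - x)\<^sup>2 + y\<^sup>2 \<le> 1"
  and sq_dist_01: "x\<^sup>2 + (1 - y)\<^sup>2 \<le> 5/4"
  and sq_dist_11: "(1 - x)\<^sup>2 + (1 - y)\<^sup>2 \<le> 5/2"
  and sq_dist_0m1: "x\<^sup>2 + (-1 - y)\<^sup>2 \<le> 5/2"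
  using x_square_le y_square_le y yx x by (simp_all add: power2_diff)

(* The points (1,1) and (0,-1) are equally far from (x, y) on the line 2 x + 4 y = 1. On either side
   of it one coordinate is eliminated by the inequality defining that side. *)
lemma sq_dist_11_or_0m1:
  "(1 - x)\<^sup>2 + (1 - y)\<^sup>2 \<le> 25/18 \<or> x\<^sup>2 + (-1 - y)\<^sup>2 \<le> 25/18"
proof (cases "2 * x + 4 * y \<le> 1")
  case True
  have "x\<^sup>2 \<le> ((1 - 4 * y) / 2)\<^sup>2"
    using True y yx by (intro power_mono) auto
  \<comment> \<open>Here \<open>6 * y \<le> 2 * x + 4 * y \<le> 1\<close>. Eliminating
    \<open>x\<close> bounds the squared distance to (0,-1) by \<open>5/4 + 5 * y\<^sup>2\<close>,
    which is at most 5/4 + 5/36 = 25/18.\<close>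
  moreover have "y\<^sup>2 \<le> (1/6)\<^sup>2"
    using True y yx by (intro power_mono) auto
  ultimately show ?thesis
    by (simp add: power2_eq_square field_simps)
next
  case False
  have "(1 - y)\<^sup>2 \<le> ((3 + 2 * x) / 4)\<^sup>2"
    using False y yx x by (intro power_mono) auto
  \<comment> \<open>Here \<open>6 * x \<ge> 2 * x + 4 * y > 1\<close>. Eliminating \<open>y\<close>
    bounds the squared distance to (1,1) by \<open>5/4 + 5/4 * (1/2 - x)\<^sup>2\<close>, again at
    most 25/18.\<close>
  moreover have "(1/2 - x)\<^sup>2 \<le> (1/3)\<^sup>2"
    using False y yx x by (intro power_mono) auto
  ultimately show ?thesis
    by (simp add: power2_eq_square field_simps)
qed

lemma lattice_points_close_0:
  "\<exists>P \<subseteq> lattice_points. 0 < card P \<and> (\<forall>p\<in>P. dist p (x, y) \<le> sqrt (1/2))"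
  using sq_dist_00
  by (intro exI[of _ "{(0, 0)}"]) (simp add: lattice_points_def dist_le_sqrt_iff)

lemma lattice_points_close_1:
  "\<exists>P \<subseteq> lattice_points. 1 < card P \<and> (\<forall>p\<in>P. dist p (x, y) \<le> sqrt 1)"
  using sq_dist_00 sq_dist_10
  by (intro exI[of _ "{(0, 0), (1, 0)}"])
    (simp add: lattice_points_def dist_le_sqrt_iff del: real_sqrt_one)

lemma lattice_points_close_2:
  "\<exists>P \<subseteq> lattice_points. 2 < card P \<and> (\<forall>p\<in>P. dist p (x, y) \<le> sqrt (5/4))"
  using sq_dist_00 sq_dist_10 sq_dist_01
  by (intro exI[of _ "{(0, 0), (1, 0), (0, 1)}"])
    (simp add: lattice_points_def dist_le_sqrt_iff)

lemma lattice_points_close_3: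
  "\<exists>P \<subseteq> lattice_points. 3 < card P \<and> (\<forall>p\<in>P. dist p (x, y) \<le> sqrt (25/18))"
proof -
  have "dist (1, 1) (x, y) \<le> sqrt (25/18) \<or> dist (0, -1) (x, y) \<le> sqrt (25/18)"
    unfolding dist_le_sqrt_iff using sq_dist_11_or_0m1 by simp
  \<comment> \<open>Only the fourth point depends on the center; the other three are within
    \<open>sqrt (5/4)\<close>, which is below \<open>sqrt (25/18)\<close>.\<close>
  then obtain q :: "real \<times> real"
    where "q \<in> {(1, 1), (0, -1)}" "dist q (x, y) \<le> sqrt (25/18)"
    by blast
  then show ?thesis
    using sq_dist_00 sq_dist_10 sq_dist_01
    by (intro exI[of _ "{(0, 0), (1, 0), (0, 1), q}"])
      (auto simp: lattice_points_def dist_le_sqrt_iff)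
qed

lemma lattice_points_close_4:
  "\<exists>P \<subseteq> lattice_points. 4 < card P \<and> (\<forall>p\<in>P. dist p (x, y) \<le> sqrt (5/2))"
  using sq_dist_00 sq_dist_10 sq_dist_01 sq_dist_11 sq_dist_0m1
  by (intro exI[of _ "{(0, 0), (1, 0), (0, 1), (1, 1), (0, -1)}"])
    (simp add: lattice_points_def dist_le_sqrt_iff)

end

theorem theorem2p1:
  "MC 0 \<and> MC_radius 0 = sqrt 2 / 2 \<and>
   MC 1 \<and> MC_radius 1 = 1 \<and>
   MC 2 \<and> MC_radius 2 = sqrt 5 / 2 \<and>
   MC 3 \<and> MC_radius 3 = 5 * sqrt 2 / 6 \<and>
   MC 4 \<and> MC_radius 4 = sqrt 10 / 2"
proof -
  have sqrt_eqs: "sqrt (1/2) = sqrt 2 / 2" "sqrt 1 = 1" "sqrt (5/4) = sqrt 5 / 2"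
    "sqrt (25/18) = 5 * sqrt 2 / 6" "sqrt (5/2) = sqrt 10 / 2"
    by (intro real_sqrt_unique; simp add: power_divide power_mult_distrib)+
  note MC_radius_eqI[OF n_enclosing_0 lattice_points_close_0]
    MC_radius_eqI[OF n_enclosing_1 lattice_points_close_1]
    MC_radius_eqI[OF n_enclosing_2 lattice_points_close_2]
    MC_radius_eqI[OF n_enclosing_3 lattice_points_close_3]
    MC_radius_eqI[OF n_enclosing_4 lattice_points_close_4]
  then show ?thesis
    unfolding sqrt_eqs by blast
qed

end
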